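(* For any fixed integer $k\ge 2$, the following linear inhomogeneous recurrence relation holds for all integers $n\ge 2k-2$: $$\mathrm{op}_{n,k}(321)=(-1)^kk-\sum_{j=1}^{2k-3}(-2)^j\binom{2k-3}{j}\,\mathrm{op}_{n-j,k}(321).$$
   Context: An ordered partition of $[n]=\{1,\dots,n\}$ into $k$ blocks is a sequence $\pi=B_1/B_2/\cdots/B_k$ of nonempty pairwise disjoint subsets with union $[n]$. It contains the pattern $321$ if there exist $1\le i_1<i_2<i_3\le k$ and $b_1\in B_{i_1}$, $b_2\in B_{i_2}$, $b_3\in B_{i_3}$ with $b_1>b_2>b_3$; otherwise it avoids $321$. $\mathrm{op}_{n,k}(321)$ is the number of ordered partitions of $[n]$ into $k$ blocks that avoid $321$ (so it is $0$ when $n<k$). *)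

theory Defs
  imports Main "HOL-Library.Disjoint_Sets"
begin

text \<open>
  Blocks are indexed from \<open>0\<close> as list positions, so \<open>B\<^sub>i\<close> is \<open>Bs ! (i - 1)\<close>.
  Disjointness is stated on positions rather than on \<open>set Bs\<close>, which excludes repeated blocks.
\<close>

definition ordered_partition :: "nat \<Rightarrow> nat \<Rightarrow> nat set list \<Rightarrow> bool" where
  "ordered_partition n k Bs \<longleftrightarrow>
     length Bs = k \<and>
     (\<forall>i<k. Bs ! i \<noteq> {}) \<and>
     disjoint_family_on (\<lambda>i. Bs ! i) {..<k} \<and>
     (\<Union>i<k. Bs ! i) = {1..n}"

definition contains_321 :: "nat set list \<Rightarrow> bool" where
  "contains_321 Bs \<longleftrightarrow>
     (\<exists>i1 i2 i3. i1 < i2 \<and> i2 < i3 \<and> i3 < length Bs \<and>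
        (\<exists>b1 \<in> Bs ! i1. \<exists>b2 \<in> Bs ! i2. \<exists>b3 \<in> Bs ! i3. b1 > b2 \<and> b2 > b3))"

definition op321 :: "nat \<Rightarrow> nat \<Rightarrow> nat" where
  "op321 n k = card {Bs. ordered_partition n k Bs \<and> \<not> contains_321 Bs}"

lemma finite_ordered_partitions: "finite {Bs. ordered_partition n k Bs}"
proof (rule finite_subset)
  show "{Bs. ordered_partition n k Bs} \<subseteq> {Bs. set Bs \<subseteq> Pow {1..n} \<and> length Bs = k}"
    by (fastforce simp: ordered_partition_def in_set_conv_nth)
  show "finite {Bs. set Bs \<subseteq> Pow {1..n} \<and> length Bs = k}"
    by (rule finite_lists_length_eq) simp
qed

end

theory Submission
  imports Defs
begin

text \<open>
  Recording for each \<open>b\<close> the index of its block turns an ordered partition of \<open>{1..n}\<close> into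
  \<open>k\<close> blocks into a word of length \<open>n\<close> that uses each of \<open>k\<close> letters. A descending triple of
  elements in blocks of increasing index is a descending triple of letters at increasing positions,
  so \<open>op321 n k\<close> counts the 321-avoiding words with letter set exactly \<open>{..<k}\<close>.

  Consider first the 321-avoiding words with letters in a finite set \<open>A\<close>, \<open>card A \<ge> 2\<close>. Read
  from left to right, a word has a future that depends only on its maximum \<open>M\<close> so far and on the
  largest letter \<open>t\<close> that is the lower end of a descent so far: the next letter must not be below
  \<open>t\<close>. A letter equal to \<open>t\<close> or \<open>M\<close> leaves the state \<open>(M, t)\<close> unchanged, a letter strictly
  between them replaces \<open>t\<close>, and a letter above \<open>M\<close> replaces \<open>M\<close>. Hence every state has exactly
  two loops, and all other moves decrease the number of letters above \<open>M\<close> plus the number of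
  letters above \<open>t\<close>. Counting words by length, the operator \<open>E - 2\<close> (\<open>E\<close> being the shift)
  removes the loops and leaves the counts for states of smaller rank, so a power of it annihilates
  the count (\<open>annihilated_words_after\<close>). One may start at \<open>M\<close>, \<open>t\<close> the second smallest and the
  smallest letter, because a descent there restricts nothing; that state has rank
  \<open>2 * card A - 3\<close>.

  To pass to words using every letter of \<open>A\<close>, split the words over \<open>A\<close> by their letter set
  \<open>B \<subseteq> A\<close>. By induction on \<open>A\<close>, the count for \<open>A\<close> is the constant
  \<open>- (-1) ^ card A * card A\<close> plus a sequence annihilated by \<open>(E - 2) ^ (2 * card A - 3)\<close> from
  length 1 on. The constants come from the single word over a one-letter set, and they are
  consistent because \<open>(-1) ^ card B * card B\<close> sums to 0 over the subsets of a set with at least two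
  elements. Expanding the power of \<open>E - 2\<close> by the binomial theorem gives the recurrence; its
  inhomogeneous term is the value of that odd power of \<open>E - 2\<close> on the constant. The shortest
  words that occur have length \<open>n - (2 * k - 3)\<close>, and \<open>n \<ge> 2 * k - 2\<close> makes this at least 1.
\<close>

section \<open>Sequences annihilated by a power of \<open>E - 2\<close>\<close>

definition shift_minus_double :: "(nat \<Rightarrow> int) \<Rightarrow> nat \<Rightarrow> int" where
  "shift_minus_double g n = g (Suc n) - 2 * g n"

definition annihilated :: "nat \<Rightarrow> (nat \<Rightarrow> int) \<Rightarrow> bool" where
  "annihilated r g \<longleftrightarrow> (\<forall>n. (shift_minus_double ^^ r) g n = 0)"

lemma annihilated_Suc: "annihilated (Suc r) g \<longleftrightarrow> annihilated r (shift_minus_double g)"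
  by (simp add: annihilated_def funpow_swap1)

lemma annihilated_zero: "annihilated r (\<lambda>n. 0)"
proof (induction r)
  case (Suc r)
  have "shift_minus_double (\<lambda>n. 0) = (\<lambda>n. 0)" by (simp add: shift_minus_double_def fun_eq_iff)
  with Suc show ?case by (simp add: annihilated_Suc)
qed (simp add: annihilated_def)

lemma annihilated_mono:
  assumes "annihilated r g" "r \<le> s"
  shows "annihilated s g"
  using assms
proof (induction r arbitrary: s g)
  case 0
  then have "g = (\<lambda>n. 0)" by (simp add: annihilated_def fun_eq_iff)
  then show ?case by (simp add: annihilated_zero)
next
  case (Suc r)
  then obtain s' where "s = Suc s'" "r \<le> s'" by (cases s) auto
  with Suc show ?case by (simp add: annihilated_Suc)
qed

lemma annihilated_diff:
  assumes "annihilated r g" "annihilated r h"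
  shows "annihilated r (\<lambda>n. g n - h n)"
  using assms
proof (induction r arbitrary: g h)
  case (Suc r)
  have "shift_minus_double (\<lambda>n. g n - h n)
      = (\<lambda>n. shift_minus_double g n - shift_minus_double h n)"
    by (simp add: shift_minus_double_def fun_eq_iff algebra_simps)
  with Suc show ?case by (simp add: annihilated_Suc)
qed (simp add: annihilated_def)

lemma annihilated_sum:
  assumes "\<And>x. x \<in> X \<Longrightarrow> annihilated r (g x)"
  shows "annihilated r (\<lambda>n. \<Sum>x\<in>X. g x n)"
  using assms
proof (induction r arbitrary: g)
  case (Suc r)
  have "shift_minus_double (\<lambda>n. \<Sum>x\<in>X. g x n) = (\<lambda>n. \<Sum>x\<in>X. shift_minus_double (g x) n)"
    by (simp add: shift_minus_double_def fun_eq_iff sum_subtractf sum_distrib_left)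
  with Suc show ?case by (simp add: annihilated_Suc)
qed (simp add: annihilated_def)

lemma annihilated_shift:
  assumes "annihilated r g"
  shows "annihilated r (\<lambda>n. g (Suc n))"
  using assms
proof (induction r arbitrary: g)
  case (Suc r)
  have "shift_minus_double (\<lambda>n. g (Suc n)) = (\<lambda>n. shift_minus_double g (Suc n))"
    by (simp add: shift_minus_double_def fun_eq_iff)
  with Suc show ?case by (simp add: annihilated_Suc)
qed (simp add: annihilated_def)

text \<open>The binomial theorem for the commuting operators \<open>E\<close> and \<open>-2\<close>.\<close>

lemma shift_minus_double_funpow:
  "(shift_minus_double ^^ r) g n = (\<Sum>j\<le>r. (-2) ^ j * int (r choose j) * g (n + r - j))"
proof (induction r arbitrary: n)
  case (Suc r)
  define a where "a j = (-2) ^ j * int (r choose j) * g (Suc n + r - j)" for j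
  define b where "b j = (-2) ^ Suc j * int (r choose j) * g (n + r - j)" for j
  have "(\<Sum>j\<le>Suc r. (-2) ^ j * int (Suc r choose j) * g (n + Suc r - j))
      = g (n + Suc r) + (\<Sum>j\<le>r. (-2) ^ Suc j * int (Suc r choose Suc j) * g (n + r - j))"
    by (subst sum.atMost_Suc_shift) simp
  also have "(\<Sum>j\<le>r. (-2) ^ Suc j * int (Suc r choose Suc j) * g (n + r - j))
      = (\<Sum>j\<le>r. a (Suc j)) + (\<Sum>j\<le>r. b j)"
    unfolding sum.distrib [symmetric]
    by (rule sum.cong) (simp_all add: a_def b_def algebra_simps)
  also have "g (n + Suc r) + ((\<Sum>j\<le>r. a (Suc j)) + (\<Sum>j\<le>r. b j))
      = (\<Sum>j\<le>Suc r. a j) + (\<Sum>j\<le>r. b j)"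
    by (subst sum.atMost_Suc_shift) (simp add: a_def)
  also have "\<dots> = (\<Sum>j\<le>r. a j) + (\<Sum>j\<le>r. b j)"
    by (simp add: a_def)
  also have "\<dots> = (shift_minus_double ^^ Suc r) g n"
    by (simp add: shift_minus_double_def [of "(shift_minus_double ^^ r) g"] Suc a_def b_def
        sum_distrib_left sum_negf algebra_simps)
  finally show ?case by simp
qed simp


section \<open>Words avoiding 321\<close>

text \<open>
  Avoidance is defined by recursion on the word, since the transfer argument below prepends
  letters. A word \<open>x # w\<close> has a 321 starting at \<open>x\<close> iff \<open>w\<close> has a descent whose top is below \<open>x\<close>;
  only the top is compared with \<open>x\<close>, the bottom being smaller still.
\<close>

primrec descent_below :: "'a::linorder \<Rightarrow> 'a list \<Rightarrow> bool" where
  "descent_below x [] \<longleftrightarrow> False"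
| "descent_below x (y # w) \<longleftrightarrow> (y < x \<and> (\<exists>z\<in>set w. z < y)) \<or> descent_below x w"

primrec avoids321 :: "'a::linorder list \<Rightarrow> bool" where
  "avoids321 [] \<longleftrightarrow> True"
| "avoids321 (x # w) \<longleftrightarrow> \<not> descent_below x w \<and> avoids321 w"

lemma descent_below_mono: "descent_below x w \<Longrightarrow> x \<le> y \<Longrightarrow> descent_below y w"
  by (induction w) auto

lemma descent_belowD: "descent_below x w \<Longrightarrow> \<exists>y\<in>set w. \<exists>z\<in>set w. z < y \<and> y < x"
  by (induction w) auto

lemma descent_below_nth:
  "descent_below x w \<longleftrightarrow>
     (\<exists>i<length w. \<exists>j<length w. i < j \<and> w ! j < w ! i \<and> w ! i < x)"
proof (induction w)
  case (Cons y w)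
  have "(\<exists>z\<in>set w. z < y) \<longleftrightarrow> (\<exists>j<length w. w ! j < y)"
    by (metis in_set_conv_nth)
  with Cons show ?case by (simp add: Ex_less_Suc2) blast
qed simp

lemma avoids321_nth:
  "avoids321 w \<longleftrightarrow>
     \<not> (\<exists>i<length w. \<exists>j<length w. \<exists>l<length w.
          i < j \<and> j < l \<and> w ! l < w ! j \<and> w ! j < w ! i)"
proof (induction w)
  case (Cons y w)
  then show ?case by (simp add: Ex_less_Suc2 descent_below_nth)
qed simp

text \<open>
  A descent \<open>M # t\<close> placed in front of \<open>w\<close> stands for any prefix with maximum \<open>M\<close> and highest
  descent bottom \<open>t\<close>. Descents of \<open>w\<close> below \<open>t\<close> are also below \<open>M\<close>, so \<open>t\<close> matters only as a
  lower bound for the letters of \<open>w\<close>.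
\<close>

lemma avoids321_state:
  assumes "t < M"
  shows "avoids321 (M # t # w) \<longleftrightarrow>
    (\<forall>z\<in>set w. t \<le> z) \<and> \<not> descent_below M w \<and> avoids321 w"
proof -
  have "descent_below t w \<Longrightarrow> descent_below M w"
    using assms by (elim descent_below_mono) simp
  with assms show ?thesis by (simp add: not_less) blast
qed

text \<open>
  The transition rule of the automaton. In the case \<open>t < x < M\<close> the new descent \<open>M # x\<close> has a
  higher bottom than \<open>M # t\<close>, so its lower bound on later letters supersedes that of \<open>t\<close>; for
  \<open>M < x\<close> the new maximum \<open>x\<close> supersedes \<open>M\<close>.
\<close>

lemma avoids321_step:
  assumes "t < M"
  shows "avoids321 (M # t # x # w) \<longleftrightarrow>
    (if x < t then False
     else if x = t \<or> x = M then avoids321 (M # t # w)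
     else if x < M then avoids321 (M # x # w)
     else avoids321 (x # t # w))"
proof -
  have step: "avoids321 (M # t # x # w) \<longleftrightarrow>
      t \<le> x \<and> (\<forall>z\<in>set w. t \<le> z) \<and> \<not> (x < M \<and> (\<exists>z\<in>set w. z < x))
      \<and> \<not> descent_below M w \<and> \<not> descent_below x w \<and> avoids321 w"
    unfolding avoids321_state [OF assms] by auto
  consider "x < t" | "x = t" | "t < x" "x < M" | "x = M" | "M < x"
    by fastforce
  then show ?thesis
  proof cases
    case 1
    then show ?thesis unfolding step by (simp add: not_le)
  next
    case 2
    have "descent_below t w \<Longrightarrow> descent_below M w"
      using assms by (elim descent_below_mono) simp
    with 2 show ?thesis
      unfolding step avoids321_state [OF assms] by (simp add: not_less) blast
  next
    case 3
    have "descent_below x w \<Longrightarrow> descent_below M w"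
      using 3 by (elim descent_below_mono) simp
    moreover have "\<forall>z\<in>set w. x \<le> z \<Longrightarrow> \<forall>z\<in>set w. t \<le> z"
      using 3 by fastforce
    ultimately show ?thesis
      using 3 unfolding step avoids321_state [OF \<open>x < M\<close>] by (simp add: not_less) blast
  next
    case 4
    with assms show ?thesis
      unfolding step avoids321_state [OF assms] by auto
  next
    case 5
    then have "t < x" using assms by simp
    have "descent_below M w \<Longrightarrow> descent_below x w"
      using 5 by (elim descent_below_mono) simp
    with 5 \<open>t < x\<close> show ?thesis
      unfolding step avoids321_state [OF \<open>t < x\<close>] by auto
  qed
qed

definition words_after :: "'a::linorder set \<Rightarrow> 'a \<Rightarrow> 'a \<Rightarrow> nat \<Rightarrow> 'a list set" where
  "words_after A M t n = {w. set w \<subseteq> A \<and> length w = n \<and> avoids321 (M # t # w)}"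

lemma finite_words_after: "finite A \<Longrightarrow> finite (words_after A M t n)"
  by (rule finite_subset [OF _ finite_lists_length_eq [of A n]]) (auto simp: words_after_def)

text \<open>
  The coefficient 2, common to all states, comes from the two first letters \<open>t\<close> and \<open>M\<close>. That it
  does not depend on the state makes \<open>E - 2\<close> the only operator needed.
\<close>

lemma card_words_after_Suc:
  assumes "finite A" "t \<in> A" "M \<in> A" "t < M"
  shows "card (words_after A M t (Suc n)) = 2 * card (words_after A M t n)
    + (\<Sum>x\<in>A - {t, M}. if x < t then 0
        else if x < M then card (words_after A M x n) else card (words_after A x t n))"
proof -
  define V where "V x = {w. set w \<subseteq> A \<and> length w = n \<and> avoids321 (M # t # x # w)}" for x
  have V: "V x = (if x < t then {} else if x = t \<or> x = M then words_after A M t n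
      else if x < M then words_after A M x n else words_after A x t n)" for x
    unfolding V_def words_after_def avoids321_step [OF \<open>t < M\<close>] by auto
  have fin: "finite (V x)" for x
    unfolding V using finite_words_after [OF \<open>finite A\<close>] by auto
  have "words_after A M t (Suc n) = (\<Union>x\<in>A. (#) x ` V x)"
    unfolding words_after_def V_def
    by (auto simp: length_Suc_conv image_iff simp del: avoids321.simps(2))
  then have "card (words_after A M t (Suc n)) = (\<Sum>x\<in>A. card ((#) x ` V x))"
    using fin \<open>finite A\<close> by (simp only:) (rule card_UN_disjoint; auto)
  also have "\<dots> = (\<Sum>x\<in>A. card (V x))"
    by (simp add: card_image)
  also have "\<dots> = (\<Sum>x\<in>A - {t, M}. card (V x)) + (\<Sum>x\<in>{t, M}. card (V x))"
    using assms by (intro sum.subset_diff) auto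
  also have "(\<Sum>x\<in>{t, M}. card (V x)) = 2 * card (words_after A M t n)"
    using \<open>t < M\<close> by (simp add: V)
  also have "(\<Sum>x\<in>A - {t, M}. card (V x)) = (\<Sum>x\<in>A - {t, M}. if x < t then 0
        else if x < M then card (words_after A M x n) else card (words_after A x t n))"
    by (rule sum.cong) (auto simp: V)
  finally show ?thesis by simp
qed

text \<open>
  Induction on the rank: applying \<open>E - 2\<close> once leaves a sum of counts for states in which
  \<open>M\<close> or \<open>t\<close> has moved up, hence has fewer letters of \<open>A\<close> above it. Rank 0 is impossible, since
  \<open>M\<close> itself lies above \<open>t\<close>.
\<close>

lemma annihilated_words_after:
  assumes "finite A" "t \<in> A" "M \<in> A" "t < M"
    and "card {x\<in>A. M < x} + card {x\<in>A. t < x} \<le> r"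
  shows "annihilated r (\<lambda>n. int (card (words_after A M t n)))"
  using assms(2-)
proof (induction r arbitrary: M t)
  case 0
  then have "M \<in> {x\<in>A. t < x}" by simp
  with 0 \<open>finite A\<close> show ?case by auto
next
  case (Suc r)
  define s where "s x n = (if x < t then 0
      else if x < M then int (card (words_after A M x n))
      else int (card (words_after A x t n)))" for x n
  have "annihilated r (s x)" if x: "x \<in> A - {t, M}" for x
  proof -
    have less: "card {y\<in>A. v < y} < card {y\<in>A. u < y}" if "v \<in> A" "u < v" for u v
      using that \<open>finite A\<close> by (intro psubset_card_mono) auto
    consider "x < t" | "t < x" "x < M" | "M < x"
      using x by fastforce
    then show ?thesis
    proof cases
      case 1
      then have "s x = (\<lambda>n. 0)" by (simp add: s_def fun_eq_iff)
      then show ?thesis by (simp add: annihilated_zero)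
    next
      case 2
      then have "s x = (\<lambda>n. int (card (words_after A M x n)))" by (auto simp: s_def fun_eq_iff)
      with Suc.IH [of x M] Suc.prems x 2 less [of x t] show ?thesis by auto
    next
      case 3
      then have "s x = (\<lambda>n. int (card (words_after A x t n)))"
        using \<open>t < M\<close> by (auto simp: s_def fun_eq_iff)
      with Suc.IH [of t x] Suc.prems x 3 less [of x M] show ?thesis by auto
    qed
  qed
  then have "annihilated r (\<lambda>n. \<Sum>x\<in>A - {t, M}. s x n)"
    by (rule annihilated_sum)
  also have "(\<lambda>n. \<Sum>x\<in>A - {t, M}. s x n)
      = shift_minus_double (\<lambda>n. int (card (words_after A M t n)))"
    using card_words_after_Suc [OF \<open>finite A\<close> Suc.prems(1-3)]
    by (simp add: shift_minus_double_def fun_eq_iff s_def if_distrib [of int] cong: if_cong)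
  finally show ?case by (simp add: annihilated_Suc)
qed

definition avoiders :: "'a::linorder set \<Rightarrow> nat \<Rightarrow> 'a list set" where
  "avoiders A n = {w. set w \<subseteq> A \<and> length w = n \<and> avoids321 w}"

lemma finite_avoiders: "finite A \<Longrightarrow> finite (avoiders A n)"
  by (rule finite_subset [OF _ finite_lists_length_eq [of A n]]) (auto simp: avoiders_def)

text \<open>
  Prefixing a word by the descent from the second smallest letter to the smallest creates no 321:
  nothing lies below \<open>t\<close>, and the only letter below \<open>M\<close> is \<open>t\<close>. The rank is then
  \<open>(card A - 2) + (card A - 1)\<close>.
\<close>

lemma annihilated_avoiders:
  assumes "finite A" "2 \<le> card A"
  shows "annihilated (2 * card A - 3) (\<lambda>n. int (card (avoiders A n)))"
proof -
  define t where "t = Min A"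
  define M where "M = Min (A - {t})"
  have "A \<noteq> {}" using assms by auto
  have t: "t \<in> A" "\<And>x. x \<in> A \<Longrightarrow> t \<le> x"
    using \<open>A \<noteq> {}\<close> \<open>finite A\<close> by (auto simp: t_def)
  have "card (A - {t}) \<noteq> 0" using assms t by simp
  then have "A - {t} \<noteq> {}" by force
  then have M: "M \<in> A - {t}" "\<And>x. x \<in> A - {t} \<Longrightarrow> M \<le> x"
    using \<open>finite A\<close> Min_in [of "A - {t}"] by (auto simp: M_def)
  have "t < M" using t M by (metis DiffD1 DiffD2 insertI1 order_le_imp_less_or_eq)
  have above_t: "{x\<in>A. t < x} = A - {t}" using t by fastforce
  have above_M: "{x\<in>A. M < x} = A - {t, M}" using t M \<open>t < M\<close> by fastforce
  have "avoids321 (M # t # w) \<longleftrightarrow> avoids321 w" if "set w \<subseteq> A" for w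
  proof -
    have "\<not> descent_below M w"
    proof
      assume "descent_below M w"
      then obtain y z where "y \<in> A" "z \<in> A" "z < y" "y < M"
        using descent_belowD \<open>set w \<subseteq> A\<close> by blast
      then have "y = t" using M(2) [of y] by (cases "y = t") auto
      with t(2) [OF \<open>z \<in> A\<close>] \<open>z < y\<close> show False by simp
    qed
    with t \<open>set w \<subseteq> A\<close> show ?thesis
      unfolding avoids321_state [OF \<open>t < M\<close>] by auto
  qed
  then have "avoiders A n = words_after A M t n" for n
    unfolding avoiders_def words_after_def by blast
  moreover have "card {x\<in>A. M < x} + card {x\<in>A. t < x} \<le> 2 * card A - 3"
    using t M assms \<open>t < M\<close> by (simp add: above_t above_M card_Diff_subset)
  ultimately show ?thesis
    using annihilated_words_after [of A t M] t M \<open>t < M\<close> \<open>finite A\<close> by simp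
qed


section \<open>Prescribing the set of letters\<close>

definition surjective_avoiders :: "'a::linorder set \<Rightarrow> nat \<Rightarrow> 'a list set" where
  "surjective_avoiders A n = {w. set w = A \<and> length w = n \<and> avoids321 w}"

lemma card_avoiders:
  assumes "finite A"
  shows "card (avoiders A n) = (\<Sum>B\<in>Pow A. card (surjective_avoiders B n))"
proof -
  have "avoiders A n = (\<Union>B\<in>Pow A. surjective_avoiders B n)"
    by (auto simp: avoiders_def surjective_avoiders_def)
  moreover have "finite (surjective_avoiders B n)" if "B \<in> Pow A" for B
    using that by (intro finite_subset [OF _ finite_avoiders [OF assms, of n]])
      (auto simp: avoiders_def surjective_avoiders_def)
  ultimately show ?thesis
    using assms by (simp add: card_UN_disjoint surjective_avoiders_def disjoint_iff)
qed

lemma sum_Pow_alternating_card: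
  assumes "finite A" "2 \<le> card A"
  shows "(\<Sum>B\<in>Pow A. (-1) ^ card B * int (card B)) = 0"
proof -
  have "(\<Sum>B\<in>Pow A. (-1) ^ card B * int (card B))
      = (\<Sum>j\<le>card A. \<Sum>B | B \<in> Pow A \<and> card B = j. (-1) ^ card B * int (card B))"
    by (rule sum.group [symmetric]) (use assms in \<open>auto intro: card_mono\<close>)
  also have "\<dots> = (\<Sum>j\<le>card A. (-1) ^ j * int j * int (card A choose j))"
    using n_subsets [OF \<open>finite A\<close>] by (intro sum.cong) simp_all
  also have "\<dots> = 0"
    using choose_alternating_linear_sum [of "card A", where 'a = int] assms by simp
  finally show ?thesis .
qed

text \<open>
  Words of length 0 are excluded by the \<open>Suc\<close>: the empty word is counted for \<open>A = {}\<close> only, where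
  it would spoil the vanishing required there. For \<open>card A \<le> 1\<close> the exponent truncates to 0 and
  the assertion is that the sequence itself vanishes, which starts the induction over subsets.
\<close>

lemma annihilated_surjective_avoiders:
  assumes "finite A"
  shows "annihilated (2 * card A - 3)
    (\<lambda>n. int (card (surjective_avoiders A (Suc n))) + (-1) ^ card A * int (card A))"
  using assms
proof (induction A rule: finite_psubset_induct)
  case (psubset A)
  define u where "u B n = int (card (surjective_avoiders B (Suc n))) + (-1) ^ card B * int (card B)"
    for B :: "'a set" and n
  show ?case
  proof (cases "2 \<le> card A")
    case True
    have "annihilated (2 * card A - 3) (\<lambda>n. \<Sum>B\<in>Pow A - {A}. u B n)"
    proof (rule annihilated_sum)
      fix B assume "B \<in> Pow A - {A}"
      then have "B \<subset> A" by auto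
      then have "annihilated (2 * card B - 3) (u B)"
        using psubset.IH unfolding u_def by blast
      then show "annihilated (2 * card A - 3) (u B)"
        using psubset_card_mono [OF \<open>finite A\<close> \<open>B \<subset> A\<close>] by (elim annihilated_mono) simp
    qed
    moreover have "annihilated (2 * card A - 3) (\<lambda>n. int (card (avoiders A (Suc n))))"
      by (rule annihilated_shift) (rule annihilated_avoiders [OF \<open>finite A\<close> True])
    ultimately have "annihilated (2 * card A - 3)
        (\<lambda>n. int (card (avoiders A (Suc n))) - (\<Sum>B\<in>Pow A - {A}. u B n))"
      by (rule annihilated_diff [rotated])
    also have "(\<lambda>n. int (card (avoiders A (Suc n))) - (\<Sum>B\<in>Pow A - {A}. u B n)) = u A"
    proof
      fix n
      \<comment> \<open>The correction terms contained in the \<open>u B\<close> cancel over all subsets.\<close>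
      have "int (card (avoiders A (Suc n))) = (\<Sum>B\<in>Pow A. u B n)"
        by (simp add: card_avoiders [OF \<open>finite A\<close>] u_def sum.distrib
            sum_Pow_alternating_card [OF \<open>finite A\<close> True])
      also have "\<dots> = u A n + (\<Sum>B\<in>Pow A - {A}. u B n)"
        using \<open>finite A\<close> by (intro sum.remove) auto
      finally show "int (card (avoiders A (Suc n))) - (\<Sum>B\<in>Pow A - {A}. u B n) = u A n"
        by simp
    qed
    finally show ?thesis by (simp add: u_def)
  next
    case False
    then consider "A = {}" | a where "A = {a}"
      using \<open>finite A\<close> by (metis card_1_singletonE card_0_eq less_2_cases not_le One_nat_def)
    then have "u A n = 0" for n
    proof cases
      case 1
      then have "surjective_avoiders A (Suc n) = {}" by (auto simp: surjective_avoiders_def)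
      with 1 show ?thesis by (simp add: u_def)
    next
      case 2
      have "avoids321 (replicate m a)" for m
        using descent_belowD [of a "replicate _ a"] by (induction m) fastforce+
      then have "surjective_avoiders A (Suc n) = {replicate (Suc n) a}"
        unfolding surjective_avoiders_def 2
        by (auto simp flip: replicate_Suc simp del: avoids321.simps(2) replicate.simps
            intro: replicate_eqI)
      with 2 show ?thesis by (simp add: u_def)
    qed
    then show ?thesis using annihilated_zero by (simp add: u_def)
  qed
qed


section \<open>Ordered partitions as words\<close>

text \<open>
  The letter at position \<open>p\<close> is the index of the block containing \<open>p + 1\<close>, as elements are counted
  from 1 and positions from 0.
\<close>

definition blocks_of_word :: "nat \<Rightarrow> nat list \<Rightarrow> nat set list" where
  "blocks_of_word k w = map (\<lambda>i. {b \<in> {1..length w}. w ! (b - 1) = i}) [0..<k]"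

text \<open>
  Exchanging positions and values reverses a descending triple into one read backwards: blocks
  \<open>i1 < i2 < i3\<close> with elements \<open>b1 > b2 > b3\<close> are the letters \<open>i3 > i2 > i1\<close> at the positions of
  \<open>b3 < b2 < b1\<close>.
\<close>

lemma contains_321_blocks_of_word:
  assumes "set w \<subseteq> {..<k}"
  shows "contains_321 (blocks_of_word k w) \<longleftrightarrow> \<not> avoids321 w"
proof
  assume "contains_321 (blocks_of_word k w)"
  then obtain i1 i2 i3 b1 b2 b3 where *: "i1 < i2" "i2 < i3" "i3 < k"
    "b1 \<in> {1..length w}" "b2 \<in> {1..length w}" "b3 \<in> {1..length w}"
    "w ! (b1 - 1) = i1" "w ! (b2 - 1) = i2" "w ! (b3 - 1) = i3" "b1 > b2" "b2 > b3"
    unfolding contains_321_def blocks_of_word_def by auto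
  then have "b3 - 1 < length w" "b2 - 1 < length w" "b1 - 1 < length w"
    "b3 - 1 < b2 - 1" "b2 - 1 < b1 - 1"
    "w ! (b1 - 1) < w ! (b2 - 1)" "w ! (b2 - 1) < w ! (b3 - 1)"
    by auto
  then show "\<not> avoids321 w"
    unfolding avoids321_nth by blast
next
  assume "\<not> avoids321 w"
  then obtain i j l where *: "i < j" "j < l" "l < length w" "w ! l < w ! j" "w ! j < w ! i"
    unfolding avoids321_nth by blast
  then have "w ! i \<in> set w" by simp
  with assms have "w ! i < k" by auto
  with * have "Suc l \<in> blocks_of_word k w ! (w ! l)" "Suc j \<in> blocks_of_word k w ! (w ! j)"
    "Suc i \<in> blocks_of_word k w ! (w ! i)" "w ! i < length (blocks_of_word k w)"
    by (auto simp: blocks_of_word_def)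
  moreover have "Suc i < Suc j" "Suc j < Suc l" using * by auto
  ultimately show "contains_321 (blocks_of_word k w)"
    unfolding contains_321_def using *(4,5) by blast
qed

lemma ordered_partition_blocks_of_word:
  assumes "set w = {..<k}"
  shows "ordered_partition (length w) k (blocks_of_word k w)"
proof -
  have block: "blocks_of_word k w ! i = {b \<in> {1..length w}. w ! (b - 1) = i}" if "i < k" for i
    using that by (simp add: blocks_of_word_def)
  have "blocks_of_word k w ! i \<noteq> {}" if "i < k" for i
  proof -
    have "i \<in> set w" using that assms by simp
    then obtain p where "p < length w" "w ! p = i" by (metis in_set_conv_nth)
    then have "Suc p \<in> blocks_of_word k w ! i" using that by (simp add: block)
    then show ?thesis by blast
  qed
  moreover have "disjoint_family_on (\<lambda>i. blocks_of_word k w ! i) {..<k}"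
    unfolding disjoint_family_on_def by (auto simp: block)
  moreover have "(\<Union>i<k. blocks_of_word k w ! i) = {1..length w}"
  proof (intro equalityI subsetI)
    fix b assume "b \<in> {1..length w}"
    moreover from this have "w ! (b - 1) \<in> set w" by (intro nth_mem) auto
    then have "w ! (b - 1) < k" using assms by simp
    ultimately show "b \<in> (\<Union>i<k. blocks_of_word k w ! i)"
      using block [of "w ! (b - 1)"] by blast
  qed (auto simp: block)
  ultimately show ?thesis
    unfolding ordered_partition_def by (simp add: blocks_of_word_def)
qed

lemma blocks_of_word_inj:
  assumes "length w = length w'" "set w \<subseteq> {..<k}" "blocks_of_word k w = blocks_of_word k w'"
  shows "w = w'"
proof (rule nth_equalityI)
  fix p assume p: "p < length w"
  define i where "i = w ! p"
  have "i < k" using assms(2) nth_mem [OF p] unfolding i_def by blast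
  then have "blocks_of_word k w ! i = {b \<in> {1..length w}. w ! (b - 1) = i}"
    "blocks_of_word k w' ! i = {b \<in> {1..length w'}. w' ! (b - 1) = i}"
    by (simp_all add: blocks_of_word_def)
  moreover have "Suc p \<in> {b \<in> {1..length w}. w ! (b - 1) = i}" using p by (simp add: i_def)
  ultimately have "Suc p \<in> {b \<in> {1..length w'}. w' ! (b - 1) = i}" using assms(3) by simp
  then show "w ! p = w' ! p" by (simp add: i_def)
qed (fact assms)

lemma blocks_of_word_surj:
  assumes "ordered_partition n k Bs"
  obtains w where "length w = n" "set w = {..<k}" "blocks_of_word k w = Bs"
proof -
  have len: "length Bs = k" and ne: "\<And>i. i < k \<Longrightarrow> Bs ! i \<noteq> {}"
    and disj: "\<And>i j b. i < k \<Longrightarrow> j < k \<Longrightarrow> b \<in> Bs ! i \<Longrightarrow> b \<in> Bs ! j \<Longrightarrow> i = j"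
    and union: "(\<Union>i<k. Bs ! i) = {1..n}"
    using assms unfolding ordered_partition_def disjoint_family_on_def by blast+
  have "\<exists>i. i < k \<and> Suc p \<in> Bs ! i" if "p < n" for p
  proof -
    have "Suc p \<in> (\<Union>i<k. Bs ! i)" unfolding union using that by simp
    then show ?thesis by auto
  qed
  then obtain f where f: "\<And>p. p < n \<Longrightarrow> f p < k \<and> Suc p \<in> Bs ! f p" by metis
  define w where "w = map f [0..<n]"
  have block: "{b \<in> {1..n}. w ! (b - 1) = i} = Bs ! i" if "i < k" for i
  proof (intro equalityI subsetI)
    fix b assume "b \<in> {b \<in> {1..n}. w ! (b - 1) = i}"
    then show "b \<in> Bs ! i" using f [of "b - 1"] by (auto simp: w_def)
  next
    fix b assume b: "b \<in> Bs ! i"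
    then have "b \<in> {1..n}" using union that by blast
    moreover from this have "f (b - 1) = i"
      using f [of "b - 1"] disj [of "f (b - 1)" i b] b that by auto
    ultimately show "b \<in> {b \<in> {1..n}. w ! (b - 1) = i}" by (auto simp: w_def)
  qed
  have "blocks_of_word k w = Bs"
    by (rule nth_equalityI) (use block len in \<open>auto simp: blocks_of_word_def w_def\<close>)
  moreover have "set w = {..<k}"
  proof (intro equalityI subsetI)
    fix i assume "i \<in> set w"
    then show "i \<in> {..<k}" using f by (auto simp: w_def)
  next
    fix i assume "i \<in> {..<k}"
    then obtain b where "b \<in> {b \<in> {1..n}. w ! (b - 1) = i}" using ne [of i] block [of i] by auto
    then show "i \<in> set w" using nth_mem [of "b - 1" w] by (auto simp: w_def)
  qed
  ultimately show ?thesis using that [of w] by (simp add: w_def)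
qed

lemma op321_eq_card_surjective_avoiders: "op321 n k = card (surjective_avoiders {..<k} n)"
proof -
  have "bij_betw (blocks_of_word k) (surjective_avoiders {..<k} n)
      {Bs. ordered_partition n k Bs \<and> \<not> contains_321 Bs}"
    unfolding bij_betw_def
  proof (intro conjI equalityI subsetI)
    show "inj_on (blocks_of_word k) (surjective_avoiders {..<k} n)"
      by (rule inj_onI) (auto simp: surjective_avoiders_def intro: blocks_of_word_inj)
  next
    fix Bs assume "Bs \<in> blocks_of_word k ` surjective_avoiders {..<k} n"
    then show "Bs \<in> {Bs. ordered_partition n k Bs \<and> \<not> contains_321 Bs}"
      using ordered_partition_blocks_of_word contains_321_blocks_of_word
      by (fastforce simp: surjective_avoiders_def)
  next
    fix Bs assume Bs: "Bs \<in> {Bs. ordered_partition n k Bs \<and> \<not> contains_321 Bs}"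
    then obtain w where "length w = n" "set w = {..<k}" "blocks_of_word k w = Bs"
      using blocks_of_word_surj by blast
    with Bs contains_321_blocks_of_word [of w k]
    show "Bs \<in> blocks_of_word k ` surjective_avoiders {..<k} n"
      by (auto simp: surjective_avoiders_def)
  qed
  then show ?thesis unfolding op321_def by (metis bij_betw_same_card)
qed

theorem corollary3p7:
  fixes n k :: nat
  assumes "k \<ge> 2" and "n \<ge> 2 * k - 2"
  shows "int (op321 n k) =
    (-1) ^ k * int k
      - (\<Sum>j = 1..2 * k - 3. (-2) ^ j * int ((2 * k - 3) choose j) * int (op321 (n - j) k))"
proof -
  define r where "r = 2 * k - 3"
  \<comment> \<open>The annihilated sequence is indexed from length 1, so length \<open>n\<close> is its index \<open>m + r\<close>.\<close>
  define m where "m = n - Suc r"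
  define c where "c = (-1) ^ k * int k"
  have n: "n = Suc (m + r)" and "odd r"
    using assms by (auto simp: m_def r_def)
  define coef where "coef j = (-2) ^ j * int (r choose j)" for j
  have "annihilated r (\<lambda>n. int (op321 (Suc n) k) + c)"
    using annihilated_surjective_avoiders [of "{..<k}"]
    by (simp add: op321_eq_card_surjective_avoiders r_def c_def)
  then have "0 = (\<Sum>j\<le>r. coef j * (int (op321 (Suc (m + r - j)) k) + c))"
    by (simp add: annihilated_def shift_minus_double_funpow coef_def)
  also have "\<dots> = (\<Sum>j\<le>r. coef j * int (op321 (n - j) k)) + (\<Sum>j\<le>r. coef j) * c"
    by (simp add: n Suc_diff_le sum.distrib sum_distrib_right distrib_left)
  also have "(\<Sum>j\<le>r. coef j) = -1"
  proof -
    have "(\<Sum>j\<le>r. coef j) = (-2 + 1) ^ r"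
      by (subst binomial_ring) (simp add: coef_def mult.commute)
    then show ?thesis using \<open>odd r\<close> by simp
  qed
  also have "(\<Sum>j\<le>r. coef j * int (op321 (n - j) k))
      = int (op321 n k) + (\<Sum>j = 1..r. coef j * int (op321 (n - j) k))"
    by (simp add: atLeast1_atMost_eq_remove0 sum.remove [of "{..r}" 0] coef_def)
  finally show ?thesis by (simp add: coef_def r_def c_def)
qed

end
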